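(* Consider the multi-message private information retrieval (MPIR) problem, described in the context, with $K>1$ messages and demand size $D$ with $1<D\le K$ such that $D$ divides $K$, and with $N=D+1$ non-colluding servers. Then the linear capacity of MPIR equals $$C=\frac{1-1/N}{1-1/N^{K/D}}.$$
   Context: MPIR problem: Let $q$ be a prime power and $m\ge1$ an integer. Each of $N>1$ non-colluding servers stores identical copies of $K>1$ messages $X_1,\dots,X_K\in\mathbb{F}_q^m$, which are independent and uniformly distributed over $\mathbb{F}_q^m$ (so each has entropy $B=m\log_2 q$ bits). A user wants the $D$ messages $X_{W}=\{X_i:i\in W\}$, where the demand index set $W$ is uniformly distributed over all $D$-subsets of $\{1,\dots,K\}$ and independent of the messages; the servers know this distribution but not the realization. Given $W$, the user generates (possibly randomly) a query $Q_n^{[W]}$ for each server $n$, independent of the messages; server $n$ returns an answer $A_n^{[W]}$ that is a deterministic function of $Q_n^{[W]}$ and $X_1,\dots,X_K$. Privacy: for every server $n$ and every $D$-subset $W^*$, $\mathbb{P}(\mathbf W=W^*\mid \mathbf Q_n^{[\mathbf W]}=Q_n^{[W]})=\mathbb{P}(\mathbf W=W^* )$. Recoverability: $X_W$ is determined by all answers, all queries and $W$. A (scalar-)linear MPIR protocol is one in which each server's answer consists only of one or more linear combinations of $X_1,\dots,X_K$ with coefficients in $\mathbb{F}_q$ (the query can be represented by the supports and coefficients of these combinations). The rate of a protocol is $DB$ divided by the expected total number of bits downloaded from all servers, $\sum_{n=1}^N\mathbb{E}[L(A_n^{[W]})]$, the expectation being over queries and messages. The linear capacity is the supremum of rates over all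 linear MPIR protocols. *)

theory Defs
  imports "HOL-Probability.Probability"
begin

text \<open>
  Model of a scalar-linear MPIR protocol over the finite field 'f (|'f| = q),
  messages X_0,...,X_{K-1} in 'f^'m  (represented as functions 'm => 'f, |'m| = m),
  servers indexed by n < N, messages by k < K.
  A query to a server is a list of coefficient vectors c (c k = coefficient of X_k);
  the answer is the list of the corresponding linear combinations.
  A protocol assigns to every demand set W a joint distribution of the queries
  (Q 0, ..., Q (N-1)) of all servers.
\<close>

type_synonym 'f query = "(nat \<Rightarrow> 'f) list"

definition demand_sets :: "nat \<Rightarrow> nat \<Rightarrow> nat set set" where
  "demand_sets K D = {W. W \<subseteq> {..<K} \<and> card W = D}"

definition lin_comb :: "nat \<Rightarrow> (nat \<Rightarrow> 'f::field) \<Rightarrow> (nat \<Rightarrow> 'm \<Rightarrow> 'f) \<Rightarrow> ('m \<Rightarrow> 'f)" where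
  "lin_comb K c X = (\<lambda>j. \<Sum>k<K. c k * X k j)"

definition answer :: "nat \<Rightarrow> 'f::field query \<Rightarrow> (nat \<Rightarrow> 'm \<Rightarrow> 'f) \<Rightarrow> ('m \<Rightarrow> 'f) list" where
  "answer K q X = map (\<lambda>c. lin_comb K c X) q"

definition joint_dist ::
  "nat \<Rightarrow> nat \<Rightarrow> (nat set \<Rightarrow> (nat \<Rightarrow> 'f query) pmf) \<Rightarrow> (nat set \<times> (nat \<Rightarrow> 'f query)) pmf" where
  "joint_dist K D P = bind_pmf (pmf_of_set (demand_sets K D)) (\<lambda>W. map_pmf (\<lambda>Q. (W, Q)) (P W))"

definition private_protocol ::
  "nat \<Rightarrow> nat \<Rightarrow> nat \<Rightarrow> (nat set \<Rightarrow> (nat \<Rightarrow> 'f query) pmf) \<Rightarrow> bool" where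
  "private_protocol N K D P \<longleftrightarrow>
     (\<forall>n<N. \<forall>Wstar \<in> demand_sets K D. \<forall>q.
        measure_pmf.prob (joint_dist K D P) {(W, Q). Q n = q} > 0 \<longrightarrow>
        measure_pmf.prob (joint_dist K D P) {(W, Q). W = Wstar \<and> Q n = q}
          / measure_pmf.prob (joint_dist K D P) {(W, Q). Q n = q}
        = measure_pmf.prob (joint_dist K D P) {(W, Q). W = Wstar})"

definition recoverable_protocol ::
  "'m itself \<Rightarrow> nat \<Rightarrow> nat \<Rightarrow> nat \<Rightarrow> (nat set \<Rightarrow> (nat \<Rightarrow> 'f::field query) pmf) \<Rightarrow> bool" where
  "recoverable_protocol _ N K D P \<longleftrightarrow>
     (\<forall>W \<in> demand_sets K D. \<forall>Q \<in> set_pmf (P W).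
        \<forall>(X :: nat \<Rightarrow> 'm \<Rightarrow> 'f) X'.
          (\<forall>n<N. answer K (Q n) X = answer K (Q n) X') \<longrightarrow> (\<forall>i\<in>W. X i = X' i))"

text \<open>Bits per message B = m log2 q; each linear combination also has B bits.\<close>
definition msg_bits :: "'f::finite itself \<Rightarrow> 'm::finite itself \<Rightarrow> real" where
  "msg_bits _ _ = real CARD('m) * log 2 (real CARD('f))"

definition expected_download ::
  "'f::finite itself \<Rightarrow> 'm::finite itself \<Rightarrow> nat \<Rightarrow> nat \<Rightarrow> nat \<Rightarrow> (nat set \<Rightarrow> (nat \<Rightarrow> 'f query) pmf) \<Rightarrow> real" where
  "expected_download tf tm N K D P =
     (\<Sum>n<N. measure_pmf.expectation (joint_dist K D P)
                (\<lambda>(W, Q). real (length (Q n)) * msg_bits tf tm))"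

definition linear_MPIR_protocol ::
  "'f::{field,finite} itself \<Rightarrow> 'm::finite itself \<Rightarrow> nat \<Rightarrow> nat \<Rightarrow> nat \<Rightarrow> (nat set \<Rightarrow> (nat \<Rightarrow> 'f query) pmf) \<Rightarrow> bool" where
  "linear_MPIR_protocol tf tm N K D P \<longleftrightarrow>
     private_protocol N K D P \<and> recoverable_protocol tm N K D P \<and>
     (\<forall>n<N. integrable (measure_pmf (joint_dist K D P)) (\<lambda>(W, Q). real (length (Q n))))"

definition rate ::
  "'f::finite itself \<Rightarrow> 'm::finite itself \<Rightarrow> nat \<Rightarrow> nat \<Rightarrow> nat \<Rightarrow> (nat set \<Rightarrow> (nat \<Rightarrow> 'f query) pmf) \<Rightarrow> real" where
  "rate tf tm N K D P = real D * msg_bits tf tm / expected_download tf tm N K D P"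

definition linear_capacity ::
  "'f::{field,finite} itself \<Rightarrow> 'm::finite itself \<Rightarrow> nat \<Rightarrow> nat \<Rightarrow> nat \<Rightarrow> real" where
  "linear_capacity tf tm N K D =
     Sup {rate tf tm N K D P | P. linear_MPIR_protocol tf tm N K D P}"

end

theory Submission
  imports Defs "HOL-Combinatorics.Permutations"
begin

text \<open>
  Upper bound. Split the messages into \<open>K / D\<close> blocks of size \<open>D\<close>. Once the first \<open>i\<close> blocks are
  known, the answers for demand block \<open>i\<close> carry \<open>D\<close> messages plus what they reveal about the later
  blocks. The latter is at least the average over the servers of the information in a single
  answer, which by privacy does not change when block \<open>i + 1\<close> is demanded instead, so it is at
  least \<open>1 / N\<close> times the total information of the answers in that case. Iterating gives
  \<open>D (1 + 1/N + \<dots> + 1/N^(K/D - 1))\<close> downloaded messages.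

  Attainment. Choose \<open>\<rho>\<close> with \<open>(1 + \<rho>)^D = N\<close>. Every server is asked for the sum of the messages in
  a random set \<open>S\<close> that contains each index independently with odds \<open>\<rho>\<close>; nothing is downloaded if
  \<open>S\<close> is empty, which has probability \<open>1 / N^(K/D)\<close>. For demand \<open>W\<close> the servers get \<open>J \<union> b\<^sub>k\<close>,
  \<open>k = 0, \<dots>, D\<close>, in cyclically shifted order, where \<open>J\<close> is a random set disjoint from \<open>W\<close>,
  \<open>b\<^sub>0 = {}\<close>, and the indicator vectors of \<open>b\<^sub>1, \<dots>, b\<^sub>D\<close> form a triangular basis of the space of
  vectors supported on \<open>W\<close>. The server marginals are right iff a set \<open>T \<subseteq> W\<close> occurs among the
  \<open>b\<^sub>k\<close> with expected multiplicity \<open>\<rho>^|T|\<close>. Triangularity only needs \<open>1 \<le> |b\<^sub>k| \<le> k\<close>, and such sizes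
  exist because the weights \<open>(D choose i) \<rho>^i\<close> are unimodal with total \<open>D + 1\<close>.
\<close>

subsection \<open>Information in linear answers\<close>

text \<open>One coordinate of \<open>answer\<close>. Scalar combinations act on the coordinates of
  the messages separately, so the converse needs only one field element per message.\<close>

definition responses :: "nat \<Rightarrow> 'f::field query \<Rightarrow> (nat \<Rightarrow> 'f) \<Rightarrow> 'f list" where
  "responses K q x = map (\<lambda>c. \<Sum>k<K. c k * x k) q"

text \<open>
  The entropy, in units of \<open>log q\<close>, of the answer to \<open>q\<close> for uniform scalar messages when those
  outside \<open>A\<close> are known: linear images of uniform vectors are uniform on their range.
\<close>

definition info :: "nat \<Rightarrow> 'f::{field,finite} query \<Rightarrow> nat set \<Rightarrow> real" where
  "info K q A = log (real CARD('f)) (real (card (responses K q ` PiE_dflt A 0 (\<lambda>_. UNIV))))"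

lemma one_less_CARD_field: "1 < real CARD('f::{field,finite})"
proof -
  have "card {0::'f, 1} \<le> CARD('f)"
    by (intro card_mono) auto
  then show ?thesis by simp
qed

text \<open>On \<open>A\<close> the map \<open>f\<close> factors through \<open>g\<close>; any
  preimage under \<open>g\<close> serves to define the factor. The comparisons of ranges by what
  determines what rest on this.\<close>

lemma card_image_le_if_determined:
  assumes "finite A" "\<And>x y. x \<in> A \<Longrightarrow> y \<in> A \<Longrightarrow> g x = g y \<Longrightarrow> f x = f y"
  shows "card (f ` A) \<le> card (g ` A)"
proof (rule surj_card_le[where f = "\<lambda>z. f (SOME x. x \<in> A \<and> g x = z)"])
  show "finite (g ` A)" using assms(1) by simp
  show "f ` A \<subseteq> (\<lambda>z. f (SOME x. x \<in> A \<and> g x = z)) ` g ` A"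
  proof
    fix z assume "z \<in> f ` A"
    then obtain x where x: "x \<in> A" "z = f x" by blast
    define y where "y = (SOME y. y \<in> A \<and> g y = g x)"
    have "y \<in> A \<and> g y = g x"
      unfolding y_def by (rule someI) (use x in simp)
    then have "z = f y" using assms(2)[of y x] x by simp
    then show "z \<in> (\<lambda>z. f (SOME x. x \<in> A \<and> g x = z)) ` g ` A"
      using x(1) unfolding y_def by blast
  qed
qed

text \<open>Here \<open>PiE_dflt A 0 (\<lambda>_. UNIV)\<close> plays the role of the vector space
  of message vectors that vanish off \<open>A\<close>.\<close>

lemma finite_supported:
  "finite A \<Longrightarrow> finite (PiE_dflt A (0::'f::{zero,finite}) (\<lambda>_. UNIV))"
  by (intro finite_PiE_dflt) auto

lemma supported_nonempty: "(\<lambda>_. 0) \<in> PiE_dflt A (0::'f::zero) (\<lambda>_. UNIV)"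
  by (simp add: PiE_dflt_def)

lemma card_responses_pos:
  fixes q :: "'f::{field,finite} query"
  assumes "finite A"
  shows "0 < card (responses K q ` PiE_dflt A 0 (\<lambda>_. UNIV))"
  using finite_supported[OF assms, where 'f = 'f] supported_nonempty[of A, where 'f = 'f]
  by (auto simp: card_gt_0_iff)

lemma info_nonneg:
  fixes q :: "'f::{field,finite} query"
  assumes "finite A"
  shows "0 \<le> info K q A"
  using card_responses_pos[OF assms, of K q] one_less_CARD_field[where 'f = 'f]
  by (simp add: info_def Suc_le_eq)

lemma info_le_nat:
  fixes q :: "'f::{field,finite} query"
  assumes "finite A" "card (responses K q ` PiE_dflt A 0 (\<lambda>_. UNIV)) \<le> CARD('f) ^ n"
  shows "info K q A \<le> real n"
proof -
  have "real (card (responses K q ` PiE_dflt A 0 (\<lambda>_. UNIV))) \<le> real CARD('f) ^ n"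
    using assms(2) by (metis of_nat_le_iff of_nat_power)
  then have "info K q A \<le> log (real CARD('f)) (real CARD('f) ^ n)"
    unfolding info_def
    using card_responses_pos[OF assms(1), of K q] one_less_CARD_field[where 'f = 'f]
    by (subst log_le_cancel_iff) auto
  also have "\<dots> = real n"
    using one_less_CARD_field[where 'f = 'f] by (simp add: log_nat_power)
  finally show ?thesis .
qed

lemma info_le_length:
  fixes q :: "'f::{field,finite} query"
  assumes "finite A"
  shows "info K q A \<le> real (length q)"
proof (rule info_le_nat[OF assms])
  have "responses K q ` PiE_dflt A 0 (\<lambda>_. UNIV) \<subseteq> {xs. set xs \<subseteq> UNIV \<and> length xs = length q}"
    by (auto simp: responses_def)
  then have "card (responses K q ` PiE_dflt A 0 (\<lambda>_. UNIV))
      \<le> card {xs::'f list. set xs \<subseteq> UNIV \<and> length xs = length q}"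
    using finite_lists_length_eq[of "UNIV::'f set"] by (intro card_mono) auto
  then show "card (responses K q ` PiE_dflt A 0 (\<lambda>_. UNIV)) \<le> CARD('f) ^ length q"
    by (simp only: card_lists_length_eq[OF finite[of "UNIV :: 'f set"]])
qed

text \<open>A bound uniform in the query, which makes the expectations of \<open>info\<close> below
  exist.\<close>

lemma info_le_card:
  fixes q :: "'f::{field,finite} query"
  assumes "finite A"
  shows "info K q A \<le> real (card A)"
proof (rule info_le_nat[OF assms])
  have "card (responses K q ` PiE_dflt A 0 (\<lambda>_. UNIV)) \<le> card (PiE_dflt A (0::'f) (\<lambda>_. UNIV))"
    by (intro card_image_le finite_supported assms)
  then show "card (responses K q ` PiE_dflt A 0 (\<lambda>_. UNIV)) \<le> CARD('f) ^ card A"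
    using assms by (simp add: card_PiE_dflt)
qed

lemma info_mono:
  fixes q q' :: "'f::{field,finite} query"
  assumes "finite A" "set q \<subseteq> set q'"
  shows "info K q A \<le> info K q' A"
proof -
  have "card (responses K q ` PiE_dflt A 0 (\<lambda>_. UNIV))
      \<le> card (responses K q' ` PiE_dflt A 0 (\<lambda>_. UNIV))"
    using assms(2) by (intro card_image_le_if_determined finite_supported assms(1))
      (auto simp: responses_def)
  then show ?thesis
    unfolding info_def
    using card_responses_pos[OF assms(1), of K q] card_responses_pos[OF assms(1), of K q']
      one_less_CARD_field[where 'f = 'f] by simp
qed

text \<open>The joint range embeds into the product of the two separate ranges.\<close>

lemma info_append:
  fixes q q' :: "'f::{field,finite} query"
  assumes "finite A"
  shows "info K (q @ q') A \<le> info K q A + info K q' A"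
proof -
  let ?V = "PiE_dflt A (0::'f) (\<lambda>_. UNIV)"
  have "card (responses K (q @ q') ` ?V)
      \<le> card ((\<lambda>x. (responses K q x, responses K q' x)) ` ?V)"
    by (intro card_image_le_if_determined finite_supported assms) (auto simp: responses_def)
  also have "\<dots> \<le> card (responses K q ` ?V \<times> responses K q' ` ?V)"
    by (intro card_mono finite_cartesian_product finite_imageI finite_supported assms) auto
  finally have "real (card (responses K (q @ q') ` ?V))
      \<le> real (card (responses K q ` ?V)) * real (card (responses K q' ` ?V))"
    by (metis card_cartesian_product of_nat_le_iff of_nat_mult)
  then have "info K (q @ q') A
      \<le> log (real CARD('f)) (real (card (responses K q ` ?V)) * real (card (responses K q' ` ?V)))"
    unfolding info_def
    using card_responses_pos[OF assms, of K "q @ q'"] card_responses_pos[OF assms, of K q]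
      card_responses_pos[OF assms, of K q'] one_less_CARD_field[where 'f = 'f] 
    by simp
  also have "\<dots> = info K q A + info K q' A"
    unfolding info_def
    using card_responses_pos[OF assms, of K q]
      card_responses_pos[OF assms, of K q'] one_less_CARD_field[where 'f = 'f]
    by (simp add: log_mult)
  finally show ?thesis .
qed

lemma info_concat:
  fixes qs :: "'f::{field,finite} query list"
  assumes "finite A"
  shows "info K (concat qs) A \<le> (\<Sum>q\<leftarrow>qs. info K q A)"
proof (induction qs)
  case Nil
  then show ?case using info_le_length[OF assms, of K "[] :: 'f query"] by simp
next
  case (Cons q qs)
  then show ?case using info_append[OF assms, of K q "concat qs"] by simp
qed

lemma responses_eq_iff:
  "responses K q x = responses K q y \<longleftrightarrow>
     (\<forall>c\<in>set q. (\<Sum>k<K. c k * x k) = (\<Sum>k<K. c k * y k))"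
  by (auto simp: responses_def)

text \<open>Chain rule. A vector on \<open>A\<close> splits as \<open>w + v\<close> with
  \<open>w\<close> on \<open>W\<close> and \<open>v\<close> on \<open>A - W\<close>. Its response
  determines \<open>w\<close>, and by linearity then also the response to \<open>v\<close>, so the
  range on \<open>A\<close> is at least as large as the set of such pairs.\<close>

lemma info_recover:
  fixes q :: "'f::{field,finite} query"
  assumes A: "finite A" and "W \<subseteq> A"
    and recover: "\<And>x. (\<And>c. c \<in> set q \<Longrightarrow> (\<Sum>k<K. c k * x k) = 0) \<Longrightarrow> \<forall>i\<in>W. x i = 0"
  shows "real (card W) + info K q (A - W) \<le> info K q A"
proof -
  let ?V = "\<lambda>A. PiE_dflt A (0::'f) (\<lambda>_. UNIV)"
  have W: "finite W" using assms by (meson finite_subset)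
  have fin: "finite (?V W \<times> ?V (A - W))"
    using A W by (intro finite_cartesian_product finite_supported) auto
  have "card (?V W \<times> responses K q ` ?V (A - W))
      = card ((\<lambda>(w, v). (w, responses K q v)) ` (?V W \<times> ?V (A - W)))"
    by (rule arg_cong[where f = card]) auto
  also have "\<dots> \<le> card ((\<lambda>(w, v). responses K q (\<lambda>k. w k + v k)) ` (?V W \<times> ?V (A - W)))"
  proof (intro card_image_le_if_determined fin, clarify)
    fix w v w' v'
    assume *: "w \<in> ?V W" "v \<in> ?V (A - W)" "w' \<in> ?V W" "v' \<in> ?V (A - W)"
      "responses K q (\<lambda>k. w k + v k) = responses K q (\<lambda>k. w' k + v' k)"
    \<comment> \<open>The difference of the two vectors lies in the common kernel of the
      combinations in \<open>q\<close>.\<close>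
    have "\<forall>i\<in>W. (w i + v i) - (w' i + v' i) = 0"
    proof (rule recover)
      fix c assume "c \<in> set q"
      then show "(\<Sum>k<K. c k * ((w k + v k) - (w' k + v' k))) = 0"
        using *(5) unfolding responses_eq_iff
        by (simp add: right_diff_distrib sum_subtractf)
    qed
    \<comment> \<open>On \<open>W\<close> both \<open>v\<close> and \<open>v'\<close> vanish; off
      \<open>W\<close> both \<open>w\<close> and \<open>w'\<close> do.\<close>
    then have ww: "w = w'"
      using * by (intro ext) (force simp: PiE_dflt_def)
    with *(5) show "w = w' \<and> responses K q v = responses K q v'"
      by (simp add: responses_eq_iff ring_distribs sum.distrib)
  qed
  also have "\<dots> \<le> card (responses K q ` ?V A)"
  proof (intro card_mono finite_imageI finite_supported A, clarify)
    fix w v assume "w \<in> ?V W" "v \<in> ?V (A - W)"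
    then have "(\<lambda>k. w k + v k) \<in> ?V A"
      using \<open>W \<subseteq> A\<close> by (auto simp: PiE_dflt_def)
    then show "responses K q (\<lambda>k. w k + v k) \<in> responses K q ` ?V A" by blast
  qed
  finally have "CARD('f) ^ card W * card (responses K q ` ?V (A - W)) \<le> card (responses K q ` ?V A)"
    using W by (simp add: card_cartesian_product card_PiE_dflt)
  then have "real CARD('f) ^ card W * real (card (responses K q ` ?V (A - W)))
      \<le> real (card (responses K q ` ?V A))"
    by (metis of_nat_le_iff of_nat_mult of_nat_power)
  then have "log (real CARD('f)) (real CARD('f) ^ card W * real (card (responses K q ` ?V (A - W))))
      \<le> info K q A"
    unfolding info_def
    using card_responses_pos[of "A - W" K q] card_responses_pos[OF A, of K q] A
      one_less_CARD_field[where 'f = 'f] by simp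
  moreover have "log (real CARD('f)) (real CARD('f) ^ card W * real (card (responses K q ` ?V (A - W))))
      = real (card W) + info K q (A - W)"
    unfolding info_def
    using card_responses_pos[of "A - W" K q] A one_less_CARD_field[where 'f = 'f]
    by (simp add: log_mult log_nat_power)
  ultimately show ?thesis by simp
qed

subsection \<open>Privacy and the lower bound on the download\<close>

lemma finite_demand_sets: "finite (demand_sets K D)"
  by (rule finite_subset[of _ "Pow {..<K}"]) (auto simp: demand_sets_def)

lemma demand_sets_nonempty:
  assumes "D \<le> K" shows "demand_sets K D \<noteq> {}"
  using obtain_subset_with_card_n[of D "{..<K}"] assms by (auto simp: demand_sets_def)

lemma pmf_joint_dist_server:
  assumes "D \<le> K"
  shows "pmf (map_pmf (\<lambda>(W, Q). (W, Q n)) (joint_dist K D P)) (W, q)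
    = (if W \<in> demand_sets K D
       then pmf (map_pmf (\<lambda>Q. Q n) (P W)) q / real (card (demand_sets K D)) else 0)"
proof -
  let ?d = "demand_sets K D"
  have fin: "finite ?d" "?d \<noteq> {}"
    using finite_demand_sets demand_sets_nonempty[OF assms] by auto
  have *: "pmf (map_pmf (Pair W') (map_pmf (\<lambda>Q. Q n) (P W'))) (W, q)
      = (if W' = W then pmf (map_pmf (\<lambda>Q. Q n) (P W)) q else 0)" for W'
    by (auto simp: pmf_map_inj' inj_on_def pmf_eq_0_set_pmf)
  have "map_pmf (\<lambda>(W, Q). (W, Q n)) (joint_dist K D P)
      = bind_pmf (pmf_of_set ?d) (\<lambda>W. map_pmf (Pair W) (map_pmf (\<lambda>Q. Q n) (P W)))"
    by (simp add: joint_dist_def map_bind_pmf map_pmf_comp)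
  then show ?thesis
    using fin by (simp add: pmf_bind_pmf_of_set * del: map_pmf_comp)
qed

lemma prob_joint_dist_demand_query:
  "measure_pmf.prob (joint_dist K D P) {(W, Q). W = Wstar \<and> Q n = q}
    = pmf (map_pmf (\<lambda>(W, Q). (W, Q n)) (joint_dist K D P)) (Wstar, q)"
  unfolding pmf_map by (rule arg_cong[where f = "measure_pmf.prob (joint_dist K D P)"]) auto

lemma prob_joint_dist_query:
  "measure_pmf.prob (joint_dist K D P) {(W, Q). Q n = q}
    = pmf (map_pmf (\<lambda>(W, Q). Q n) (joint_dist K D P)) q"
  unfolding pmf_map by (rule arg_cong[where f = "measure_pmf.prob (joint_dist K D P)"]) auto

lemma prob_joint_dist_demand:
  assumes "D \<le> K" "Wstar \<in> demand_sets K D"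
  shows "measure_pmf.prob (joint_dist K D P) {(W, Q). W = Wstar} = 1 / real (card (demand_sets K D))"
proof -
  have "map_pmf fst (joint_dist K D P) = pmf_of_set (demand_sets K D)"
    by (simp add: joint_dist_def map_bind_pmf map_pmf_comp bind_return_pmf' map_pmf_const)
  moreover have "measure_pmf.prob (joint_dist K D P) {(W, Q). W = Wstar}
      = pmf (map_pmf fst (joint_dist K D P)) Wstar"
      unfolding pmf_map by (rule arg_cong[where f = "measure_pmf.prob (joint_dist K D P)"]) auto
  ultimately show ?thesis
    using assms finite_demand_sets[of K D] demand_sets_nonempty[OF assms(1)] by simp
qed

text \<open>Bayes' rule: the posterior of a uniform demand equals the prior iff the conditional law
  of the query is its average over all demands. Queries of total probability 0, about which the
  definition says nothing, have probability 0 under every demand.\<close>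

lemma private_protocol_iff_marginals:
  assumes "D \<le> K"
  shows "private_protocol N K D P \<longleftrightarrow>
    (\<forall>n<N. \<forall>W\<in>demand_sets K D.
       map_pmf (\<lambda>Q. Q n) (P W) = map_pmf (\<lambda>(W, Q). Q n) (joint_dist K D P))"
proof -
  let ?d = "demand_sets K D"
  let ?M = "\<lambda>n. map_pmf (\<lambda>(W, Q). Q n) (joint_dist K D P)"
  have c: "real (card ?d) > 0"
    using finite_demand_sets[of K D] demand_sets_nonempty[OF assms] by (simp add: card_gt_0_iff)
  have zero: "pmf (map_pmf (\<lambda>Q. Q n) (P W)) q = 0" if "W \<in> ?d" "pmf (?M n) q = 0" for n W q
  proof -
    have "pmf (map_pmf (\<lambda>(W, Q). (W, Q n)) (joint_dist K D P)) (W, q) \<le> pmf (?M n) q"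
      unfolding prob_joint_dist_demand_query[symmetric] prob_joint_dist_query[symmetric]
      by (intro measure_pmf.finite_measure_mono) auto
    then have "pmf (map_pmf (\<lambda>Q. Q n) (P W)) q / real (card ?d) \<le> 0"
      using that by (simp only: pmf_joint_dist_server[OF assms] if_True)
    then show ?thesis
      using c pmf_nonneg[of "map_pmf (\<lambda>Q. Q n) (P W)" q] by (simp add: divide_le_0_iff)
  qed
  have "private_protocol N K D P \<longleftrightarrow>
    (\<forall>n<N. \<forall>W\<in>?d. \<forall>q. pmf (?M n) q > 0 \<longrightarrow> 
       pmf (map_pmf (\<lambda>Q. Q n) (P W)) q / real (card ?d) / pmf (?M n) q = 1 / real (card ?d))"
    unfolding private_protocol_def prob_joint_dist_demand_query prob_joint_dist_query
    by (simp add: pmf_joint_dist_server[OF assms] prob_joint_dist_demand[OF assms] del: pmf_map)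
  also have "\<dots> \<longleftrightarrow>
    (\<forall>n<N. \<forall>W\<in>?d. \<forall>q. pmf (?M n) q > 0 \<longrightarrow> pmf (map_pmf (\<lambda>Q. Q n) (P W)) q = pmf (?M n) q)"
    using c by (intro all_cong1 imp_cong ball_cong refl) (auto simp: field_simps)
  also have "\<dots> \<longleftrightarrow> (\<forall>n<N. \<forall>W\<in>?d. map_pmf (\<lambda>Q. Q n) (P W) = ?M n)"
  proof (intro all_cong1 imp_cong ball_cong refl iffI)
    fix n W assume "W \<in> ?d"
      and *: "\<forall>q. pmf (?M n) q > 0 \<longrightarrow> pmf (map_pmf (\<lambda>Q. Q n) (P W)) q = pmf (?M n) q"
    show "map_pmf (\<lambda>Q. Q n) (P W) = ?M n"
    proof (rule pmf_eqI)
      fix q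
      show "pmf (map_pmf (\<lambda>Q. Q n) (P W)) q = pmf (?M n) q"
        using * zero[OF \<open>W \<in> ?d\<close>, of n q] pmf_nonneg[of "?M n" q]
        by (cases "pmf (?M n) q = 0") (auto simp: order_less_le)
    qed
  qed simp
  finally show ?thesis .
qed

section \<open>Expected information and the recursion over blocks\<close>

lemma integrable_bounded_pmf:
  fixes f :: "'a \<Rightarrow> real"
  assumes "\<And>x. 0 \<le> f x" "\<And>x. f x \<le> b"
  shows "integrable (measure_pmf p) f"
  using assms by (intro measure_pmf.integrable_const_bound[where B = b]) auto

lemma expectation_info_recover:
  fixes P :: "nat set \<Rightarrow> (nat \<Rightarrow> 'f::{field,finite} query) pmf"
  assumes "recoverable_protocol TYPE('m) N K D P" "W \<in> demand_sets K D" "finite A" "W \<subseteq> A"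
  shows "real D + measure_pmf.expectation (P W) (\<lambda>Q. info K (concat (map Q [0..<N])) (A - W))
    \<le> measure_pmf.expectation (P W) (\<lambda>Q. info K (concat (map Q [0..<N])) A)"
proof -
  have int: "integrable (measure_pmf (P W)) (\<lambda>Q. info K (concat (map Q [0..<N])) B)"
    if "finite B" for B
    using info_nonneg[OF that] info_le_card[OF that] by (intro integrable_bounded_pmf)
  have "real D + info K (concat (map Q [0..<N])) (A - W) \<le> info K (concat (map Q [0..<N])) A"
    if Q: "Q \<in> set_pmf (P W)" for Q
  proof -
    have "real (card W) + info K (concat (map Q [0..<N])) (A - W) \<le> info K (concat (map Q [0..<N])) A"
    proof (rule info_recover[OF assms(3,4)])
      fix x :: "nat \<Rightarrow> 'f"
      assume x: "\<And>c. c \<in> set (concat (map Q [0..<N])) \<Longrightarrow> (\<Sum>k<K. c k * x k) = 0"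
      \<comment> \<open>Copying the scalar into every coordinate and comparing with the zero
        messages carries recoverability over to the scalar kernel.\<close>
      define X :: "nat \<Rightarrow> 'm \<Rightarrow> 'f" where "X = (\<lambda>k _. x k)"
      have "answer K (Q n) X = answer K (Q n) (\<lambda>_ _. 0)" if "n < N" for n
      proof -
        have "set (Q n) \<subseteq> set (concat (map Q [0..<N]))" using that by force
        then show ?thesis using x by (simp add: answer_def lin_comb_def X_def subset_iff)
      qed
      then have "\<forall>i\<in>W. X i = (\<lambda>_. 0)"
        using assms(1,2) Q unfolding recoverable_protocol_def by blast
      then show "\<forall>i\<in>W. x i = 0"
        by (auto simp: X_def fun_eq_iff)
    qed
    then show ?thesis using assms(2) by (simp add: demand_sets_def)
  qed
  then have "measure_pmf.expectation (P W) (\<lambda>Q. real D + info K (concat (map Q [0..<N])) (A - W))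
      \<le> measure_pmf.expectation (P W) (\<lambda>Q. info K (concat (map Q [0..<N])) A)"
    using int assms(3) by (intro integral_mono_AE) (auto simp: AE_measure_pmf_iff)
  then show ?thesis using int[of "A - W"] assms(3) by simp
qed

text \<open>Passes to a bound that depends only on the marginals of the single servers, hence by
  privacy not on the demand.\<close>

lemma expectation_info_le_sum:
  fixes p :: "(nat \<Rightarrow> 'f::{field,finite} query) pmf"
  assumes "finite A"
  shows "measure_pmf.expectation p (\<lambda>Q. info K (concat (map Q [0..<N])) A)
    \<le> (\<Sum>n<N. measure_pmf.expectation (map_pmf (\<lambda>Q. Q n) p) (\<lambda>q. info K q A))"
proof -
  have int: "integrable (measure_pmf p) (\<lambda>Q. info K (F Q) A)" for F
    using info_nonneg[OF assms] info_le_card[OF assms] by (intro integrable_bounded_pmf)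
  have "info K (concat (map Q [0..<N])) A \<le> (\<Sum>n<N. info K (Q n) A)" for Q :: "nat \<Rightarrow> 'f query"
    using info_concat[OF assms, of K "map Q [0..<N]"]
    by (simp add: comp_def interv_sum_list_conv_sum_set_nat atLeast0LessThan)
  then have "measure_pmf.expectation p (\<lambda>Q. info K (concat (map Q [0..<N])) A)
      \<le> measure_pmf.expectation p (\<lambda>Q. \<Sum>n<N. info K (Q n) A)"
    by (intro integral_mono Bochner_Integration.integrable_sum int)
  also have "\<dots> = (\<Sum>n<N. measure_pmf.expectation p (\<lambda>Q. info K (Q n) A))"
    by (intro Bochner_Integration.integral_sum int)
  finally show ?thesis by simp
qed

text \<open>Each single answer is part of the joint answer. This leads back from the marginals to
  the joint law, at the cost of the factor \<open>N\<close>.\<close>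

lemma sum_expectation_info_le:
  fixes p :: "(nat \<Rightarrow> 'f::{field,finite} query) pmf"
  assumes "finite A"
  shows "(\<Sum>n<N. measure_pmf.expectation (map_pmf (\<lambda>Q. Q n) p) (\<lambda>q. info K q A))
    \<le> real N * measure_pmf.expectation p (\<lambda>Q. info K (concat (map Q [0..<N])) A)"
proof -
  have int: "integrable (measure_pmf p) (\<lambda>Q. info K (F Q) A)" for F
    using info_nonneg[OF assms] info_le_card[OF assms] by (intro integrable_bounded_pmf)
  have "measure_pmf.expectation (map_pmf (\<lambda>Q. Q n) p) (\<lambda>q. info K q A)
      \<le> measure_pmf.expectation p (\<lambda>Q. info K (concat (map Q [0..<N])) A)" if "n < N" for n
  proof -
    have "set (Q n) \<subseteq> set (concat (map Q [0..<N]))" for Q :: "nat \<Rightarrow> 'f query"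
      using that by force
    then show ?thesis
      unfolding integral_map_pmf by (intro integral_mono info_mono assms int)
  qed
  then have "(\<Sum>n<N. measure_pmf.expectation (map_pmf (\<lambda>Q. Q n) p) (\<lambda>q. info K q A))
      \<le> (\<Sum>n<N. measure_pmf.expectation p (\<lambda>Q. info K (concat (map Q [0..<N])) A))"
    by (intro sum_mono) simp
  then show ?thesis by simp
qed

text \<open>Induction on the number \<open>m\<close> of final blocks that are still unknown; the
  demand is the first of these.\<close>

lemma expectation_info_lower_bound:
  fixes P :: "nat set \<Rightarrow> (nat \<Rightarrow> 'f::{field,finite} query) pmf"
  assumes priv: "private_protocol N K D P" and rec: "recoverable_protocol TYPE('m) N K D P"
    and "0 < N" "K = r * D" "D \<le> K" "m \<le> r" "0 < m"
  shows "(\<Sum>j<m. real D / real N ^ j)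
    \<le> measure_pmf.expectation (P {(r - m) * D..<(r - m + 1) * D})
        (\<lambda>Q. info K (concat (map Q [0..<N])) {(r - m) * D..<K})"
  using \<open>m \<le> r\<close> \<open>0 < m\<close>
proof (induction m)
  case 0
  then show ?case by simp
next
  case (Suc m)
  define i where "i = r - Suc m"
  let ?W = "\<lambda>i. {i * D..<(i + 1) * D}"
  let ?A = "\<lambda>i. {i * D..<K}"
  let ?e = "\<lambda>i j. measure_pmf.expectation (P (?W i)) (\<lambda>Q. info K (concat (map Q [0..<N])) (?A j))"
  have W: "?W i \<in> demand_sets K D" if "i < r" for i
  proof -
    have "(i + 1) * D \<le> K"
      unfolding \<open>K = r * D\<close> using that by (intro mult_le_mono1) simp
    then show ?thesis by (auto simp: demand_sets_def)
  qed
  have i: "i < r" using Suc.prems by (simp add: i_def)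
  have "?A i - ?W i = ?A (i + 1)" by auto
  moreover have "?W i \<subseteq> ?A i" using W[OF i] by (simp add: demand_sets_def subset_iff)
  ultimately have step: "real D + ?e i (i + 1) \<le> ?e i i"
    using expectation_info_recover[OF rec W[OF i], of "?A i"] by simp
  have "(\<Sum>j<m. real D / real N ^ j) / real N \<le> ?e i (i + 1)"
  \<comment> \<open>If only the last block was unknown, there is no next block to demand, but the
    sum on the left is empty.\<close>
  proof (cases "m = 0")
    case True
    then show ?thesis by (simp add: integral_nonneg info_nonneg)
  next
    case False
    then have i': "i + 1 < r" "r - m = i + 1" using Suc.prems by (auto simp: i_def)
    have "(\<Sum>j<m. real D / real N ^ j) \<le> ?e (i + 1) (i + 1)"
      using Suc.IH False Suc.prems i'(2) by simp
    also have "\<dots> \<le> (\<Sum>n<N. measure_pmf.expectation (map_pmf (\<lambda>Q. Q n) (P (?W (i + 1)))) (\<lambda>q. info K q (?A (i + 1))))"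
      by (intro expectation_info_le_sum) simp
    \<comment> \<open>Privacy exchanges demand block \<open>i + 1\<close> for block
      \<open>i\<close>.\<close>
    also have "\<dots> = (\<Sum>n<N. measure_pmf.expectation (map_pmf (\<lambda>Q. Q n) (P (?W i))) (\<lambda>q. info K q (?A (i + 1))))"
      using priv W[OF i] W[OF i'(1)] unfolding private_protocol_iff_marginals[OF \<open>D \<le> K\<close>]
      by (intro sum.cong refl) (simp del: integral_map_pmf)
    also have "\<dots> \<le> real N * ?e i (i + 1)"
      by (intro sum_expectation_info_le) simp
    finally show ?thesis using \<open>0 < N\<close> by (simp add: divide_le_eq mult.commute)
  qed
  moreover have "(\<Sum>j<Suc m. real D / real N ^ j) = real D + (\<Sum>j<m. real D / real N ^ j) / real N"
    by (simp add: sum.lessThan_Suc_shift sum_divide_distrib mult.commute del: sum.lessThan_Suc)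
  ultimately show ?case using step by (simp add: i_def)
qed

text \<open>The recursion with all \<open>r\<close> blocks unknown; an answer carries at most as
  many symbols of information as it has entries.\<close>

lemma expected_download_lower_bound:
  fixes P :: "nat set \<Rightarrow> (nat \<Rightarrow> 'f::{field,finite} query) pmf"
  assumes prot: "linear_MPIR_protocol TYPE('f) TYPE('m::finite) N K D P"
    and "0 < N" "K = r * D" "0 < r"
  shows "(\<Sum>j<r. real D / real N ^ j) * msg_bits TYPE('f) TYPE('m)
    \<le> expected_download TYPE('f) TYPE('m) N K D P"
proof -
  let ?J = "joint_dist K D P"
  have DK: "D \<le> K" using assms by simp
  have prot': "private_protocol N K D P" "recoverable_protocol TYPE('m) N K D P"
    and int: "\<And>n. n < N \<Longrightarrow> integrable (measure_pmf ?J) (\<lambda>(W, Q). real (length (Q n)))"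
    using prot by (auto simp: linear_MPIR_protocol_def)
  have W: "{0..<D} \<in> demand_sets K D" using DK by (auto simp: demand_sets_def)
  have "(\<Sum>j<r. real D / real N ^ j)
      \<le> measure_pmf.expectation (P {0..<D}) (\<lambda>Q. info K (concat (map Q [0..<N])) {0..<K})"
    using expectation_info_lower_bound[OF prot' \<open>0 < N\<close> \<open>K = r * D\<close> DK order_refl \<open>0 < r\<close>] by simp
  also have "\<dots> \<le> (\<Sum>n<N. measure_pmf.expectation (map_pmf (\<lambda>Q. Q n) (P {0..<D})) (\<lambda>q. info K q {0..<K}))"
    by (intro expectation_info_le_sum) simp
  also have "\<dots> = (\<Sum>n<N. measure_pmf.expectation (map_pmf (\<lambda>(W, Q). Q n) ?J) (\<lambda>q. info K q {0..<K}))"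
    using prot'(1) W unfolding private_protocol_iff_marginals[OF DK]
    by (intro sum.cong refl) (simp del: integral_map_pmf)
  also have "\<dots> = (\<Sum>n<N. measure_pmf.expectation ?J (\<lambda>(W, Q). info K (Q n) {0..<K}))"
    by (simp add: case_prod_unfold)
  also have "\<dots> \<le> (\<Sum>n<N. measure_pmf.expectation ?J (\<lambda>(W, Q). real (length (Q n))))"
  proof (intro sum_mono integral_mono int)
    show "integrable (measure_pmf ?J) (\<lambda>(W, Q). info K (Q n) {0..<K})" for n
      by (rule integrable_bounded_pmf[where b = "real (card {0..<K})"])
        (auto simp del: card_atLeastLessThan intro: info_nonneg info_le_card)
  qed (auto intro: info_le_length)
  finally have *: "(\<Sum>j<r. real D / real N ^ j)
      \<le> (\<Sum>n<N. measure_pmf.expectation ?J (\<lambda>(W, Q). real (length (Q n))))" .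
  have "0 \<le> msg_bits TYPE('f) TYPE('m)"
    using one_less_CARD_field[where 'f = 'f] by (simp add: msg_bits_def)
  from mult_right_mono[OF * this] show ?thesis
    by (simp add: expected_download_def case_prod_unfold sum_distrib_right)
qed

subsection \<open>Random supports\<close>

lemma pmf_embed_pmf_finite:
  assumes "finite A" "\<And>x. 0 \<le> f x" "\<And>x. x \<notin> A \<Longrightarrow> f x = 0" "sum f A = 1"
  shows "pmf (embed_pmf f) x = f x"
proof (rule pmf_embed_pmf)
  have "(\<integral>\<^sup>+x. ennreal (f x) \<partial>count_space UNIV) = (\<Sum>x\<in>A. ennreal (f x))"
    using assms by (intro nn_integral_count_space') auto
  also have "\<dots> = 1"
    using assms by (simp add: sum_ennreal)
  finally show "(\<integral>\<^sup>+x. ennreal (f x) \<partial>count_space UNIV) = 1" .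
qed (use assms in auto)

text \<open>The product measure under which each element of \<open>V\<close> is included with
  probability \<rho> / (1 + \<rho>).\<close>

definition random_subset :: "real \<Rightarrow> 'a set \<Rightarrow> 'a set pmf" where
  "random_subset \<rho> V = embed_pmf (\<lambda>S. if S \<subseteq> V then \<rho> ^ card S / (1 + \<rho>) ^ card V else 0)"

lemma sum_power_card_Pow:
  fixes \<rho> :: "'a::comm_semiring_1"
  assumes "finite V"
  shows "(\<Sum>S\<in>Pow V. \<rho> ^ card S) = (1 + \<rho>) ^ card V"
  using prod_add[OF assms, of "\<lambda>_. \<rho>" "\<lambda>_. 1"] by (simp add: add.commute)

lemma pmf_random_subset:
  assumes "finite V" "0 \<le> \<rho>"
  shows "pmf (random_subset \<rho> V) S = (if S \<subseteq> V then \<rho> ^ card S / (1 + \<rho>) ^ card V else 0)"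
  unfolding random_subset_def
proof (rule pmf_embed_pmf_finite[of "Pow V"])
  have "(\<Sum>S\<in>Pow V. if S \<subseteq> V then \<rho> ^ card S / (1 + \<rho>) ^ card V else 0)
      = (\<Sum>S\<in>Pow V. \<rho> ^ card S) / (1 + \<rho>) ^ card V"
    unfolding sum_divide_distrib by (intro sum.cong) auto
  then show "(\<Sum>S\<in>Pow V. if S \<subseteq> V then \<rho> ^ card S / (1 + \<rho>) ^ card V else 0) = 1"
    using assms by (simp add: sum_power_card_Pow)
qed (use assms in auto)

text \<open>Transitivity of the symmetric group on subsets of a fixed size: a bijection of the sets
  is glued to one of their complements.\<close>

lemma ex_permutes_image_eq:
  assumes "finite W" "T \<subseteq> W" "T' \<subseteq> W" "card T = card T'"
  obtains \<tau> where "\<tau> permutes W" "\<tau> ` T = T'"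
proof -
  have fin: "finite T" "finite T'" using assms by (auto intro: finite_subset)
  obtain f where f: "bij_betw f T T'"
    using finite_same_card_bij[OF fin] assms by blast
  have "card (W - T) = card (W - T')"
    using assms fin by (simp add: card_Diff_subset)
  then obtain g where g: "bij_betw g (W - T) (W - T')"
    using finite_same_card_bij[of "W - T" "W - T'"] assms by blast
  define \<tau> where "\<tau> x = (if x \<in> T then f x else if x \<in> W then g x else x)" for x
  have 1: "bij_betw \<tau> T T'"
    using f by (subst bij_betw_cong[of T \<tau> f]) (auto simp: \<tau>_def)
  have 2: "bij_betw \<tau> (W - T) (W - T')"
    using g by (subst bij_betw_cong[of "W - T" \<tau> g]) (auto simp: \<tau>_def)
  have "bij_betw \<tau> (T \<union> (W - T)) (T' \<union> (W - T'))"
    using 1 2 by (intro bij_betw_combine) auto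
  then have "bij_betw \<tau> W W"
    using assms by (simp add: Un_absorb1)
  then have "\<tau> permutes W"
    using assms by (intro bij_imp_permutes) (auto simp: \<tau>_def)
  with 1 show thesis using that by (auto simp: bij_betw_def)
qed

lemma pmf_permuted_set:
  assumes W: "finite W" and "A \<subseteq> W" "T \<subseteq> W"
  shows "pmf (map_pmf (\<lambda>\<pi>. \<pi> ` A) (pmf_of_set {\<pi>. \<pi> permutes W})) T
    = (if card T = card A then 1 / real (card W choose card A) else 0)"
proof -
  let ?\<Pi> = "{\<pi>. \<pi> permutes W}"
  let ?U = "pmf_of_set ?\<Pi>"
  let ?M = "map_pmf (\<lambda>\<pi>. \<pi> ` A) ?U"
  let ?S = "{T. T \<subseteq> W \<and> card T = card A}"
  have fin: "finite ?\<Pi>" "?\<Pi> \<noteq> {}"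
    using finite_permutations[OF W] permutes_id[of W] by (simp, metis empty_iff mem_Collect_eq)
  have supp: "set_pmf ?M \<subseteq> ?S"
  proof
    fix T assume "T \<in> set_pmf ?M"
    then obtain \<pi> where \<pi>: "\<pi> permutes W" "T = \<pi> ` A" using fin by auto
    have "\<pi> ` A \<subseteq> W" using image_mono[OF \<open>A \<subseteq> W\<close>, of \<pi>] permutes_image[OF \<pi>(1)] by simp
    then show "T \<in> ?S" using \<pi> by (simp add: card_image[OF permutes_inj_on])
  qed
  have eq: "pmf ?M T' = pmf ?M T" if T: "T \<in> ?S" "T' \<in> ?S" for T T'
  proof -
    obtain \<tau> where \<tau>: "\<tau> permutes W" "\<tau> ` T = T'"
      using ex_permutes_image_eq[OF W, of T T'] T by auto
    \<comment> \<open>Left composition with \<tau> leaves the uniform law invariant, so all subsets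
      of the right size are equally likely.\<close>
    have "bij_betw (\<lambda>\<pi>. \<tau> \<circ> \<pi>) ?\<Pi> ?\<Pi>"
    proof (rule bij_betwI[where g = "\<lambda>\<pi>. inv \<tau> \<circ> \<pi>"])
      show "inv \<tau> \<circ> (\<tau> \<circ> \<pi>) = \<pi>" "\<tau> \<circ> (inv \<tau> \<circ> \<pi>) = \<pi>" for \<pi>
        using permutes_inv_o[OF \<tau>(1)] by (simp_all only: comp_assoc[symmetric] id_comp)
    qed (use \<tau>(1) in \<open>auto intro: permutes_compose permutes_inv\<close>)
    then have "?U = map_pmf (\<lambda>\<pi>. \<tau> \<circ> \<pi>) ?U"
      by (rule map_pmf_of_set_bij_betw[symmetric]) (use fin in simp_all)
    then have "?M = map_pmf (\<lambda>\<pi>. \<pi> ` A) (map_pmf (\<lambda>\<pi>. \<tau> \<circ> \<pi>) ?U)"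
      by (rule arg_cong)
    also have "\<dots> = map_pmf ((`) \<tau>) ?M"
      by (simp add: map_pmf_comp image_comp)
    finally have "pmf ?M (\<tau> ` T) = pmf (map_pmf ((`) \<tau>) ?M) (\<tau> ` T)"
      by (rule arg_cong)
    also have "\<dots> = pmf ?M T"
      using permutes_inj[OF \<tau>(1)] by (intro pmf_map_inj' injI) (simp add: inj_image_eq_iff)
    finally show ?thesis using \<tau>(2) by simp
  qed
  show ?thesis
  proof (cases "card T = card A")
    case True
    then have T: "T \<in> ?S" using assms by simp
    have finS: "finite ?S" using W by simp
    have "1 = (\<Sum>T'\<in>?S. pmf ?M T')"
      using sum_pmf_eq_1[OF finS supp] by (rule sym)
    also have "\<dots> = (\<Sum>T'\<in>?S. pmf ?M T)"
      by (intro sum.cong refl eq T)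
    also have "\<dots> = real (card W choose card A) * pmf ?M T"
      using n_subsets[OF W, of "card A"] by simp
    finally have "real (card W choose card A) * pmf ?M T = 1" by simp
    then show ?thesis
      using True by (metis mult_zero_left nonzero_mult_div_cancel_left zero_neq_one)
  next
    case False
    then have "T \<notin> set_pmf ?M" using supp by auto
    then show ?thesis using False by (simp add: pmf_eq_0_set_pmf)
  qed
qed

section \<open>Staircase distributions and binomial weights\<close>

definition clamp :: "nat \<Rightarrow> real \<Rightarrow> real" where
  "clamp k x = max 0 (min 1 (x - real k))"

lemma sum_clamp: "0 \<le> x \<Longrightarrow> (\<Sum>k<n. clamp k x) = min x (real n)"
  by (induction n) (auto simp: clamp_def)

text \<open>
  Lay intervals of lengths \<open>u 0, u 1, \<dots>\<close> end to end; \<open>q k\<close> is the law of the index of the interval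
  containing a uniform point of \<open>[k, k + 1]\<close>. The part of \<open>[k, k + 1]\<close> left of \<open>x\<close> has length
  \<open>clamp k x\<close>.
\<close>

lemma ex_staircase_pmfs:
  fixes u :: "nat \<Rightarrow> real"
  assumes nonneg: "\<And>i. 0 \<le> u i" and "u 0 = 1" and zero: "\<And>i. D < i \<Longrightarrow> u i = 0"
    and total: "(\<Sum>i\<le>D. u i) = real D + 1"
    and prefix: "\<And>k. k \<le> D \<Longrightarrow> real k + 1 \<le> (\<Sum>i\<le>k. u i)"
  obtains q :: "nat \<Rightarrow> nat pmf" where
    "\<And>k i. k \<le> D \<Longrightarrow> i \<in> set_pmf (q k) \<Longrightarrow> i \<le> k"
    "\<And>k i. k \<le> D \<Longrightarrow> 0 < k \<Longrightarrow> i \<in> set_pmf (q k) \<Longrightarrow> 0 < i"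
    "\<And>i. (\<Sum>k\<le>D. pmf (q k) i) = u i"
proof -
  define U where "U i = (\<Sum>l<i. u l)" for i
  have U_mono: "U i \<le> U j" if "i \<le> j" for i j
    unfolding U_def using that nonneg by (intro sum_mono2) auto
  have U0: "U 0 = 0" and U1: "U (Suc 0) = 1" and U_Suc: "U (Suc i) = U i + u i" for i
    using \<open>u 0 = 1\<close> by (simp_all add: U_def)
  have U_nonneg: "0 \<le> U i" for i using U_mono[of 0 i] U0 by simp
  have U_D: "U (Suc D) = real D + 1"
    using total by (simp add: U_def lessThan_Suc_atMost)
  have U_const: "U i = real D + 1" if "D < i" for i
  proof -
    have "U (Suc D + d) = real D + 1" for d
      by (induction d) (use U_D U_Suc zero in auto)
    from this[of "i - Suc D"] that show ?thesis by simp
  qed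
  have U_le: "U i \<le> real (Suc D)" for i
    using U_mono[of i "Suc D"] U_const[of i] U_D by (cases "D < i") auto
  have U_ge: "real k + 1 \<le> U (Suc k)" if "k \<le> D" for k
    using prefix[OF that] by (simp add: U_def lessThan_Suc_atMost)
  \<comment> \<open>The length of the overlap of \<open>[k, k + 1]\<close> with interval
    \<open>i\<close>, whose ends are \<open>U i\<close> and \<open>U (Suc i)\<close>.\<close>
  define w where "w k i = clamp k (U (Suc i)) - clamp k (U i)" for k i
  define q where "q k = embed_pmf (w k)" for k
  have pmf_q: "pmf (q k) i = w k i" if "k \<le> D" for k i
    unfolding q_def
  proof (rule pmf_embed_pmf_finite[of "{..<Suc D}"])
    show "0 \<le> w k i" for i
      using U_mono[of i "Suc i"] by (simp add: w_def clamp_def)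
    show "w k i = 0" if "i \<notin> {..<Suc D}" for i
      using that by (simp add: w_def U_const)
    have "sum (w k) {..<Suc D} = clamp k (U (Suc D)) - clamp k (U 0)"
      unfolding w_def by (rule sum_lessThan_telescope)
    then show "sum (w k) {..<Suc D} = 1"
      using that by (simp add: clamp_def U_D U0)
  qed simp
  show thesis
  proof (rule that[of q])
    fix k i assume k: "k \<le> D" and "i \<in> set_pmf (q k)"
    then have w: "w k i \<noteq> 0" by (simp add: set_pmf_iff pmf_q)
    show "i \<le> k"
    proof (rule ccontr)
      assume "\<not> i \<le> k"
      \<comment> \<open>The prefix bound: interval \<open>i\<close> starts at or after the end of
        \<open>[k, k + 1]\<close>.\<close>
      then have "real k + 1 \<le> U i" "real k + 1 \<le> U (Suc i)"
        using U_ge[OF k] U_mono[of "Suc k" i] U_mono[of "Suc k" "Suc i"] by auto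
      with w show False by (simp add: w_def clamp_def)
    qed
    show "0 < i" if "0 < k"
    proof (rule ccontr)
      assume "\<not> 0 < i"
      \<comment> \<open>Interval 0 is \<open>[0, 1]\<close>, so its overlap with
        \<open>[k, k + 1]\<close> has length 0 when \<open>k > 0\<close>.\<close>
      with w that show False by (simp add: w_def clamp_def U0 U1)
    qed
  next
    fix i
    have "(\<Sum>k\<le>D. pmf (q k) i) = (\<Sum>k<Suc D. w k i)"
      unfolding lessThan_Suc_atMost by (intro sum.cong) (auto simp: pmf_q)
    \<comment> \<open>The unit intervals with \<open>k \<le> D\<close> tile
      \<open>[0, D + 1]\<close>, which contains interval \<open>i\<close>, so the overlaps add up to
      its length.\<close>
    also have "\<dots> = U (Suc i) - U i"
      using U_nonneg U_le[of i] U_le[of "Suc i"]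
      by (simp only: w_def sum_subtractf sum_clamp min_absorb1)
    finally show "(\<Sum>k\<le>D. pmf (q k) i) = u i" by (simp add: U_Suc)
  qed
qed

text \<open>
  The weights start at 1, and once one of them is below 1 all later ones are (log-concavity).
  As the mean of all \<open>D + 1\<close> weights is 1, every prefix has mean at least 1.
\<close>

lemma binomial_weights_prefix:
  fixes \<rho> :: real
  assumes "0 < \<rho>" "(1 + \<rho>) ^ D = real D + 1" "k \<le> D"
  shows "real k + 1 \<le> (\<Sum>i\<le>k. real (D choose i) * \<rho> ^ i)"
proof -
  define u where "u i = real (D choose i) * \<rho> ^ i" for i
  have u_nonneg: "0 \<le> u i" for i using assms by (simp add: u_def)
  have ratio: "u (Suc i) * (real i + 1) = u i * ((real D - real i) * \<rho>)" for i
  proof (cases "i \<le> D")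
    case True
    have "Suc i * (D choose Suc i) = (D - i) * (D choose i)"
      using binomial_absorption[of i D] binomial_absorb_comp[of D i] by simp
    then have "(real i + 1) * real (D choose Suc i) = (real D - real i) * real (D choose i)"
      using True by (metis (no_types, lifting) of_nat_Suc of_nat_diff of_nat_mult add.commute)
    then have "\<rho> ^ Suc i * ((real i + 1) * real (D choose Suc i))
        = \<rho> ^ Suc i * ((real D - real i) * real (D choose i))"
      by simp
    then show ?thesis by (simp add: u_def algebra_simps)
  qed (simp add: u_def binomial_eq_0)
  \<comment> \<open>The quotient \<open>u (Suc i) / u i\<close> is
    \<open>(D - i) * \<rho> / (i + 1)\<close>, which decreases in \<open>i\<close>. At the first
    weight below 1 the preceding quotient is below 1, and so are all later ones;
    \<open>u 0 = 1\<close> starts the induction vacuously.\<close>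
  have ratio_less: "(real D - real i) * \<rho> < real i + 1" if "u i < 1" for i
    using that
  proof (induction i)
    case 0
    then show ?case by (simp add: u_def)
  next
    case (Suc i)
    have "(real D - real i) * \<rho> < real i + 1"
    proof (cases "u i < 1 \<or> real D \<le> real i")
      case True
      then show ?thesis
        using Suc.IH assms(1) by (auto intro: order.strict_trans1[OF mult_nonpos_nonneg])
    next
      case False
      then have "(real D - real i) * \<rho> \<le> u i * ((real D - real i) * \<rho>)"
        using assms(1) mult_right_mono[of 1 "u i" "(real D - real i) * \<rho>"] by simp
      also have "\<dots> = u (Suc i) * (real i + 1)" by (simp add: ratio)
      also have "\<dots> < 1 * (real i + 1)"
        using Suc.prems by (intro mult_strict_right_mono) auto
      finally show ?thesis by simp
    qed
    moreover have "(real D - real (Suc i)) * \<rho> \<le> (real D - real i) * \<rho>"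
      using assms(1) by (intro mult_right_mono) auto
    ultimately show ?case by simp
  qed
  have step: "u (Suc i) < 1" if "u i < 1" for i
  proof -
    have "u (Suc i) * (real i + 1) \<le> u i * (real i + 1)"
      unfolding ratio using ratio_less[OF that] u_nonneg by (intro mult_left_mono) auto
    then have "u (Suc i) \<le> u i" by (rule mult_right_le_imp_le) simp
    then show ?thesis using that by simp
  qed
  have less: "u j < 1" if "u i < 1" "i \<le> j" for i j
    using that(2,1) by (induction j rule: dec_induct) (auto intro: step)
  have total: "(\<Sum>i\<le>D. u i) = real D + 1"
    using binomial_ring[of \<rho> 1 D] assms(2) by (simp add: u_def add.commute)
  show ?thesis
  proof (cases "u k < 1")
    case True
    \<comment> \<open>The \<open>D - k\<close> weights after \<open>k\<close> are all below 1, which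
      leaves at least \<open>k + 1\<close> of the total \<open>D + 1\<close> for the prefix.\<close>
    have "(\<Sum>i\<le>D. u i) = (\<Sum>i\<le>k. u i) + (\<Sum>i\<in>{k<..D}. u i)"
      using \<open>k \<le> D\<close> by (subst sum.union_disjoint[symmetric]) (auto intro: sum.cong)
    moreover have "(\<Sum>i\<in>{k<..D}. u i) \<le> (\<Sum>i\<in>{k<..D}. 1)"
      using less[OF True] by (intro sum_mono) (auto intro: less_imp_le)
    ultimately show ?thesis
      using total \<open>k \<le> D\<close> by (simp add: u_def of_nat_diff)
  next
    case False
    then have "(\<Sum>i\<le>k. 1) \<le> (\<Sum>i\<le>k. u i)"
      using less by (intro sum_mono) (meson atMost_iff not_le_imp_less)
    then show ?thesis by (simp add: u_def)
  qed
qed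

text \<open>
  Meant for \<open>s \<le> k \<le> length e\<close>, with \<open>s = 0\<close> only for \<open>k = 0\<close>: for \<open>k > 0\<close> the last element in the
  order \<open>e\<close> is the \<open>k\<close>-th one (counted from 1), hence triangularity.
\<close>

definition staircase_set :: "nat list \<Rightarrow> nat \<Rightarrow> nat \<Rightarrow> nat set" where
  "staircase_set e k s = (if s = 0 then {} else insert (e ! (k - 1)) (set (take (s - 1) e)))"

lemma staircase_set_subset:
  assumes "k \<le> length e" "s \<le> k"
  shows "staircase_set e k s \<subseteq> set e"
  using assms by (auto simp: staircase_set_def dest: in_set_takeD)

lemma card_staircase_set:
  assumes "distinct e" "k \<le> length e" "s \<le> k"
  shows "card (staircase_set e k s) = s"
proof (cases s)
  case (Suc t)
  have "e ! (k - 1) \<notin> set (take t e)"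
  proof
    assume "e ! (k - 1) \<in> set (take t e)"
    then obtain l where "l < t" "e ! l = e ! (k - 1)"
      using assms Suc by (auto simp: in_set_conv_nth)
    then show False
      using assms Suc nth_eq_iff_index_eq[OF assms(1), of l "k - 1"] by auto
  qed
  then show ?thesis
    using assms Suc by (simp add: staircase_set_def distinct_card)
qed (simp add: staircase_set_def)

text \<open>Forward substitution: set number \<open>l + 1\<close> consists of \<open>e ! l\<close>
  and elements at positions before \<open>l\<close>, where \<open>y\<close> is already known to
  vanish.\<close>

lemma staircase_sums_zero_imp_zero:
  fixes y :: "nat \<Rightarrow> 'f::comm_monoid_add"
  assumes "distinct e" "\<And>k. k \<le> length e \<Longrightarrow> s k \<le> k" "\<And>k. 0 < k \<Longrightarrow> k \<le> length e \<Longrightarrow> 0 < s k"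
    and sums: "\<And>k. k \<le> length e \<Longrightarrow> sum y (staircase_set e k (s k)) = 0"
  shows "\<forall>i\<in>set e. y i = 0"
proof -
  have "y (e ! l) = 0" if "l < length e" for l
    using that
  proof (induction l rule: less_induct)
    case (less l)
    let ?t = "s (Suc l) - 1"
    have s: "0 < s (Suc l)" "s (Suc l) \<le> Suc l"
      using assms(2)[of "Suc l"] assms(3)[of "Suc l"] less.prems by auto
    have zero: "y i = 0" if "i \<in> set (take ?t e)" for i
      using that s less by (auto simp: in_set_conv_nth)
    have "e ! l \<notin> set (take ?t e) \<or> y (e ! l) = 0"
      using zero by blast
    moreover have "sum y (insert (e ! l) (set (take ?t e))) = 0"
      using sums[of "Suc l"] less.prems s by (simp add: staircase_set_def)
    ultimately show ?case
      using zero by (cases "e ! l \<in> set (take ?t e)") auto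
  qed
  then show ?thesis by (auto simp: in_set_conv_nth)
qed

text \<open>The set \<open>b k\<close> equals \<open>T\<close> with probability
  \<open>pmf (q k) (card T) / (D choose card T)\<close>. Summing over \<open>k\<close> turns the
  numerator into \<open>(D choose card T) * \<rho> ^ card T\<close>, the weight for which the size
  laws \<open>q k\<close> are built.\<close>

lemma ex_random_basis:
  fixes \<rho> :: real
  assumes W: "finite W" "card W = D" and \<rho>: "0 < \<rho>" "(1 + \<rho>) ^ D = real D + 1"
  obtains B :: "(nat \<Rightarrow> nat set) pmf" where
    "\<And>b k. b \<in> set_pmf B \<Longrightarrow> k \<le> D \<Longrightarrow> b k \<subseteq> W"
    "\<And>b. b \<in> set_pmf B \<Longrightarrow> b 0 = {}"
    "\<And>b (x :: nat \<Rightarrow> 'f::comm_monoid_add). b \<in> set_pmf B \<Longrightarrow>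
       (\<And>k. k \<le> D \<Longrightarrow> sum x (b k) = 0) \<Longrightarrow> \<forall>i\<in>W. x i = 0"
    "\<And>T. T \<subseteq> W \<Longrightarrow> (\<Sum>k\<le>D. pmf (map_pmf (\<lambda>b. b k) B) T) = \<rho> ^ card T"
proof -
  define u where "u i = real (D choose i) * \<rho> ^ i" for i
  obtain q :: "nat \<Rightarrow> nat pmf" where
    q_le: "\<And>k i. k \<le> D \<Longrightarrow> i \<in> set_pmf (q k) \<Longrightarrow> i \<le> k" and
    q_pos: "\<And>k i. k \<le> D \<Longrightarrow> 0 < k \<Longrightarrow> i \<in> set_pmf (q k) \<Longrightarrow> 0 < i" and
    q_sum: "\<And>i. (\<Sum>k\<le>D. pmf (q k) i) = u i"
  proof (rule ex_staircase_pmfs[of u D])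
    show "(\<Sum>i\<le>D. u i) = real D + 1"
      using binomial_ring[of \<rho> 1 D] \<rho>(2) by (simp add: u_def add.commute)
    show "real k + 1 \<le> (\<Sum>i\<le>k. u i)" if "k \<le> D" for k
      unfolding u_def by (rule binomial_weights_prefix[OF \<rho> that])
  qed (use \<rho> in \<open>auto simp: u_def\<close>)
  define e where "e = sorted_list_of_set W"
  have e: "distinct e" "set e = W" "length e = D"
    using W by (simp_all add: e_def)
  let ?U = "pmf_of_set {\<pi>. \<pi> permutes W}"
  have U: "set_pmf ?U = {\<pi>. \<pi> permutes W}"
    using finite_permutations[OF W(1)] permutes_id[of W] by (intro set_pmf_of_set) (blast, simp)
  let ?q = "Pi_pmf {..D} 0 q"
  \<comment> \<open>Independent sizes, then one relabelling of \<open>W\<close> common to all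
    \<open>k\<close>: being common it preserves triangularity, being uniform it makes
    \<open>b k\<close> uniform given its size.\<close>
  define B where "B = bind_pmf ?q (\<lambda>s. map_pmf (\<lambda>\<pi> k. \<pi> ` staircase_set e k (s k)) ?U)"
  have B: "\<exists>s \<pi>. (\<forall>k\<le>D. s k \<in> set_pmf (q k)) \<and> \<pi> permutes W \<and> b = (\<lambda>k. \<pi> ` staircase_set e k (s k))"
    if b: "b \<in> set_pmf B" for b
  proof -
    obtain s where s: "s \<in> set_pmf ?q" "b \<in> (\<lambda>\<pi> k. \<pi> ` staircase_set e k (s k)) ` set_pmf ?U"
      using b unfolding B_def set_bind_pmf set_map_pmf by blast
    have "\<forall>k\<le>D. s k \<in> set_pmf (q k)"
      using s(1) by (auto simp: set_Pi_pmf PiE_dflt_def)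
    with s(2) show ?thesis unfolding U by blast
  qed
  show thesis
  proof (rule that[of B])
    fix b k assume "b \<in> set_pmf B" and k: "k \<le> D"
    then obtain s \<pi> where s: "\<forall>k\<le>D. s k \<in> set_pmf (q k)" and \<pi>: "\<pi> permutes W"
      and b: "b = (\<lambda>k. \<pi> ` staircase_set e k (s k))"
      using B by blast
    have "staircase_set e k (s k) \<subseteq> W"
      using staircase_set_subset[of k e "s k"] e k q_le[of k "s k"] s by simp
    then show "b k \<subseteq> W"
      using image_mono[of _ W \<pi>] permutes_image[OF \<pi>] b by blast
  next
    fix b assume "b \<in> set_pmf B"
    then obtain s \<pi> where s: "\<forall>k\<le>D. s k \<in> set_pmf (q k)"
      and b: "b = (\<lambda>k. \<pi> ` staircase_set e k (s k))"
      using B by blast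
    have "s 0 = 0" using q_le[of 0 "s 0"] s by simp
    then show "b 0 = {}" by (simp add: b staircase_set_def)
  next
    fix b and x :: "nat \<Rightarrow> 'f"
    assume "b \<in> set_pmf B" and x: "\<And>k. k \<le> D \<Longrightarrow> sum x (b k) = 0"
    then obtain s \<pi> where s: "\<forall>k\<le>D. s k \<in> set_pmf (q k)" and \<pi>: "\<pi> permutes W"
      and b: "b = (\<lambda>k. \<pi> ` staircase_set e k (s k))"
      using B by blast
    have "\<forall>i\<in>set e. (x \<circ> \<pi>) i = 0"
    proof (rule staircase_sums_zero_imp_zero[OF e(1), of s])
      show "sum (x \<circ> \<pi>) (staircase_set e k (s k)) = 0" if "k \<le> length e" for k
        using x[of k] that e b by (simp add: sum.reindex[OF permutes_inj_on[OF \<pi>]])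
    qed (use q_le q_pos s e in auto)
    then have "\<forall>i\<in>\<pi> ` W. x i = 0" by (auto simp: e)
    then show "\<forall>i\<in>W. x i = 0" by (simp add: permutes_image[OF \<pi>])
  next
    fix T assume T: "T \<subseteq> W"
    have "pmf (map_pmf (\<lambda>b. b k) B) T = pmf (q k) (card T) / real (D choose card T)" if k: "k \<le> D" for k
    proof -
      have "map_pmf (\<lambda>b. b k) B
          = bind_pmf (map_pmf (\<lambda>s. s k) ?q) (\<lambda>i. map_pmf (\<lambda>\<pi>. \<pi> ` staircase_set e k i) ?U)"
        by (simp add: B_def map_bind_pmf bind_map_pmf map_pmf_comp)
      also have "map_pmf (\<lambda>s. s k) ?q = q k"
        using k by (simp add: Pi_pmf_component)
      finally have "pmf (map_pmf (\<lambda>b. b k) B) T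
          = measure_pmf.expectation (q k) (\<lambda>i. pmf (map_pmf (\<lambda>\<pi>. \<pi> ` staircase_set e k i) ?U) T)"
        by (simp add: pmf_bind)
      also have "\<dots> = (\<Sum>i\<le>k. pmf (q k) i * pmf (map_pmf (\<lambda>\<pi>. \<pi> ` staircase_set e k i) ?U) T)"
        using q_le[OF k] by (subst integral_measure_pmf[of "{..k}"]) auto
      also have "\<dots> = (\<Sum>i\<le>k. if i = card T then pmf (q k) (card T) / real (D choose card T) else 0)"
      proof (intro sum.cong refl)
        fix i assume "i \<in> {..k}"
        then have "staircase_set e k i \<subseteq> W" "card (staircase_set e k i) = i"
          using staircase_set_subset[of k e i] card_staircase_set[of e k i] e k by auto
        then show "pmf (q k) i * pmf (map_pmf (\<lambda>\<pi>. \<pi> ` staircase_set e k i) ?U) T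
            = (if i = card T then pmf (q k) (card T) / real (D choose card T) else 0)"
          using pmf_permuted_set[OF W(1) _ T] W(2) by auto
      qed
      also have "\<dots> = pmf (q k) (card T) / real (D choose card T)"
      proof (cases "card T \<le> k")
        case False
        then have "pmf (q k) (card T) = 0"
          using q_le[OF k, of "card T"] by (auto simp: pmf_eq_0_set_pmf)
        then show ?thesis by simp
      qed simp
      finally show ?thesis .
    qed
    then have "(\<Sum>k\<le>D. pmf (map_pmf (\<lambda>b. b k) B) T)
        = (\<Sum>k\<le>D. pmf (q k) (card T)) / real (D choose card T)"
      by (simp add: sum_divide_distrib)
    also have "\<dots> = \<rho> ^ card T"
      using card_mono[OF W(1) T] W(2) by (simp add: q_sum u_def)
    finally show "(\<Sum>k\<le>D. pmf (map_pmf (\<lambda>b. b k) B) T) = \<rho> ^ card T" .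
  qed
qed

section \<open>Cyclic shifts and the supports sent to the servers\<close>

lemma bij_betw_add_mod:
  assumes "0 < N"
  shows "bij_betw (\<lambda>s. (n + s) mod N) {..<N} {..<N::nat}"
proof -
  have "inj_on (\<lambda>s. (n + s) mod N) {..<N}"
  proof
    fix s t assume st: "s \<in> {..<N}" "t \<in> {..<N}" "(n + s) mod N = (n + t) mod N"
    then have "(int n + int s) mod int N = (int n + int t) mod int N"
      by (metis of_nat_add zmod_int)
    then have "int s mod int N = int t mod int N"
      by (metis add_diff_cancel_left' mod_diff_left_eq)
    then show "s = t" using st by simp
  qed
  moreover have "(\<lambda>s. (n + s) mod N) ` {..<N} \<subseteq> {..<N}" using assms by auto
  ultimately show ?thesis
    by (simp add: bij_betw_def endo_inj_surj)
qed

text \<open>The uniform shift shows each server a uniformly chosen member of the basis family, so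
  its part inside \<open>W\<close> has mass \<open>\<rho> ^ card T / (D + 1)\<close>, that of
  independent inclusion. Together with the independent part \<open>J\<close> outside
  \<open>W\<close> this is independent inclusion on all indices.\<close>

lemma ex_random_supports:
  fixes \<rho> :: real
  assumes W: "W \<in> demand_sets K D" and \<rho>: "0 < \<rho>" "(1 + \<rho>) ^ D = real D + 1"
  obtains R :: "(nat \<Rightarrow> nat set) pmf" where
    "\<And>S (x :: nat \<Rightarrow> 'f::cancel_comm_monoid_add). S \<in> set_pmf R \<Longrightarrow>
       (\<And>n. n < D + 1 \<Longrightarrow> sum x (S n) = 0) \<Longrightarrow> \<forall>i\<in>W. x i = 0"
    "\<And>n. map_pmf (\<lambda>S. S n) R = random_subset \<rho> {..<K}"
proof -
  have WK: "W \<subseteq> {..<K}" "card W = D" "finite W"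
    using W by (auto simp: demand_sets_def intro: finite_subset)
  obtain B :: "(nat \<Rightarrow> nat set) pmf" where
    B_sub: "\<And>b k. b \<in> set_pmf B \<Longrightarrow> k \<le> D \<Longrightarrow> b k \<subseteq> W" and
    B_0: "\<And>b. b \<in> set_pmf B \<Longrightarrow> b 0 = {}" and
    B_rec: "\<And>b (x :: nat \<Rightarrow> 'f). b \<in> set_pmf B \<Longrightarrow>
       (\<And>k. k \<le> D \<Longrightarrow> sum x (b k) = 0) \<Longrightarrow> \<forall>i\<in>W. x i = 0" and
    B_sum: "\<And>T. T \<subseteq> W \<Longrightarrow> (\<Sum>k\<le>D. pmf (map_pmf (\<lambda>b. b k) B) T) = \<rho> ^ card T"
    using ex_random_basis[OF WK(3,2) \<rho>] by blast
  let ?N = "D + 1"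
  let ?V = "{..<K} - W"
  let ?J = "random_subset \<rho> ?V"
  let ?unif = "pmf_of_set {..<?N}"
  have J_sub: "J \<subseteq> ?V" if "J \<in> set_pmf ?J" for J
    using that \<rho> by (simp add: set_pmf_iff pmf_random_subset split: if_splits)
  define R where "R = bind_pmf ?J (\<lambda>J. bind_pmf ?unif (\<lambda>s.
    map_pmf (\<lambda>b n. J \<union> b ((n + s) mod ?N)) B))"
  show thesis
  proof (rule that[of R])
    fix S and x :: "nat \<Rightarrow> 'f"
    assume "S \<in> set_pmf R" and x: "\<And>n. n < ?N \<Longrightarrow> sum x (S n) = 0"
    then obtain J s b where "J \<in> set_pmf ?J" and b: "b \<in> set_pmf B"
      and S: "S = (\<lambda>n. J \<union> b ((n + s) mod ?N))"
      unfolding R_def set_bind_pmf set_map_pmf by blast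
    have J: "J \<subseteq> ?V" by (rule J_sub) fact
    have J_fin: "finite J" using J finite_subset by auto
    have sum: "sum x J + sum x (b k) = 0" if "k \<le> D" for k
    proof -
      have "k \<in> (\<lambda>n. (s + n) mod ?N) ` {..<?N}"
        using bij_betw_add_mod[of ?N s] that by (simp add: bij_betw_def)
      then obtain n where n: "n < ?N" "k = (n + s) mod ?N"
        by (auto simp: add.commute)
      have "finite (b k)" "J \<inter> b k = {}"
        using B_sub[OF b that] WK(3) J by (auto intro: finite_subset)
      then show ?thesis
        using x[OF n(1)] n(2) J_fin by (simp add: S sum.union_disjoint)
    qed
    \<comment> \<open>The server that receives \<open>J \<union> b 0 = J\<close> reveals the
      interference, which is then subtracted from the other sums.\<close>
    have "sum x J = 0" using sum[of 0] B_0[OF b] by simp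
    with sum have "sum x (b k) = 0" if "k \<le> D" for k
      using that by simp
    then show "\<forall>i\<in>W. x i = 0" by (rule B_rec[OF b])
  next
    fix n
    define M where "M = bind_pmf ?unif (\<lambda>k. map_pmf (\<lambda>b. b k) B)"
    have pmf_M: "pmf M T = \<rho> ^ card T / real ?N" if "T \<subseteq> W" for T
    proof -
      have "pmf M T = (\<Sum>k<?N. pmf (map_pmf (\<lambda>b. b k) B) T) / real ?N"
        unfolding M_def by (subst pmf_bind_pmf_of_set) auto
      also have "{..<?N} = {..D}" by auto
      finally show ?thesis using B_sum[OF that] by simp
    qed
    have "set_pmf ?unif = {..<?N}"
      by (intro set_pmf_of_set) auto
    then have M_sub: "T \<subseteq> W" if "T \<in> set_pmf M" for T
      using that by (auto simp: M_def less_Suc_eq_le dest: B_sub[THEN subsetD])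
    \<comment> \<open>Shifting by \<open>n\<close> preserves the uniform law of \<open>s\<close>, so
      the marginal is the same at every server.\<close>
    have unif: "?unif = map_pmf (\<lambda>s. (n + s) mod ?N) ?unif"
      by (rule map_pmf_of_set_bij_betw[OF bij_betw_add_mod, symmetric]) auto
    have "M = bind_pmf ?unif (\<lambda>s. map_pmf (\<lambda>b. b ((n + s) mod ?N)) B)"
      unfolding M_def by (subst unif) (simp only: bind_map_pmf)
    then have marginal: "map_pmf (\<lambda>S. S n) R = map_pmf (\<lambda>(J, T). J \<union> T) (pair_pmf ?J M)"
      by (simp add: R_def map_bind_pmf map_pmf_comp pair_pmf_def bind_return_pmf bind_assoc_pmf
          map_pmf_def)
    show "map_pmf (\<lambda>S. S n) R = random_subset \<rho> {..<K}"
    proof (rule pmf_eqI)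
      fix S
      let ?P = "pair_pmf ?J M"
      \<comment> \<open>The parts lie in the disjoint sets \<open>?V\<close> and \<open>W\<close>,
        so their union determines both.\<close>
      have inj: "inj_on (\<lambda>(J, T). J \<union> T) (set_pmf ?P)"
      proof (rule inj_onI, clarsimp)
        fix J T J' T'
        assume "J \<in> set_pmf ?J" "T \<in> set_pmf M" "J' \<in> set_pmf ?J" "T' \<in> set_pmf M" "J \<union> T = J' \<union> T'"
        with J_sub[of J] J_sub[of J'] M_sub[of T] M_sub[of T'] show "J = J' \<and> T = T'"
          by blast
      qed
      show "pmf (map_pmf (\<lambda>S. S n) R) S = pmf (random_subset \<rho> {..<K}) S"
      proof (cases "S \<subseteq> {..<K}")
        case True
        have fin: "finite S" using True finite_subset by auto
        have pmfs: "pmf ?J (S - W) = \<rho> ^ card (S - W) / (1 + \<rho>) ^ card ?V"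
          "pmf M (S \<inter> W) = \<rho> ^ card (S \<inter> W) / real ?N"
          using True \<rho> by (auto simp: pmf_random_subset pmf_M)
        have "(S - W, S \<inter> W) \<in> set_pmf ?P"
          using \<rho> pmfs by (simp add: set_pmf_iff)
        from pmf_map_inj[OF inj this]
        have "pmf (map_pmf (\<lambda>S. S n) R) S = pmf ?J (S - W) * pmf M (S \<inter> W)"
          by (simp add: marginal pmf_pair Un_Diff_Int)
        \<comment> \<open>The denominators combine because \<open>D + 1\<close> is
          \<open>(1 + \<rho>) ^ D\<close>.\<close>
        also have "\<dots> = \<rho> ^ (card (S - W) + card (S \<inter> W)) / (1 + \<rho>) ^ (card ?V + D)"
          by (simp add: pmfs power_add \<rho>(2))
        also have "card (S - W) + card (S \<inter> W) = card S"
          using fin by (metis add.commute card_Int_Diff)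
        also have "card ?V + D = K"
          using WK card_mono[of "{..<K}" W] by (simp add: card_Diff_subset)
        finally show ?thesis using True \<rho> by (simp add: pmf_random_subset)
      next
        case False
        have "S \<notin> set_pmf (map_pmf (\<lambda>S. S n) R)"
          using False J_sub M_sub WK(1) by (fastforce simp: marginal)
        then show ?thesis using False \<rho> by (simp add: pmf_random_subset pmf_eq_0_set_pmf)
      qed
    qed
  qed
qed

subsection \<open>The optimal protocol\<close>

text \<open>The empty support is encoded as the empty list instead of a zero combination; this is
  the whole saving over one combination per server.\<close>

definition indicator_query :: "nat set \<Rightarrow> 'f::zero_neq_one query" where
  "indicator_query S = (if S = {} then [] else [\<lambda>k. if k \<in> S then 1 else 0])"

lemma answer_indicator_query_eqD:
  fixes X X' :: "nat \<Rightarrow> 'm \<Rightarrow> 'f::field"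
  assumes "answer K (indicator_query S) X = answer K (indicator_query S) X'" "S \<subseteq> {..<K}"
  shows "(\<Sum>k\<in>S. X k j - X' k j) = 0"
proof (cases "S = {}")
  case False
  have eq: "(\<Sum>k<K. (if k \<in> S then 1 else 0) * y k) = (\<Sum>k\<in>S. y k)" for y :: "nat \<Rightarrow> 'f"
    using assms(2) by (intro sum.mono_neutral_cong_right) auto
  show ?thesis
    using assms(1) False by (simp add: answer_def indicator_query_def lin_comb_def fun_eq_iff eq sum_subtractf)
qed simp

text \<open>Every server sees the same query law \<open>?M\<close> under every demand, which gives
  privacy; its expected answer length is the probability that the random support is
  nonempty.\<close>

lemma ex_optimal_protocol:
  fixes D K r :: nat
  assumes "0 < D" "D \<le> K" "K = r * D"
  obtains P :: "nat set \<Rightarrow> (nat \<Rightarrow> 'f::{field,finite} query) pmf" where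
    "linear_MPIR_protocol TYPE('f) TYPE('m::finite) (D + 1) K D P"
    "expected_download TYPE('f) TYPE('m) (D + 1) K D P
       = real (D + 1) * (1 - 1 / real (D + 1) ^ r) * msg_bits TYPE('f) TYPE('m)"
proof -
  define \<rho> where "\<rho> = root D (real D + 1) - 1"
  have "root D 1 < root D (real D + 1)"
    using assms by (intro real_root_less_mono) auto
  then have \<rho>: "0 < \<rho>" "(1 + \<rho>) ^ D = real D + 1"
    using assms by (simp_all add: \<rho>_def)
  let ?good = "\<lambda>W R. (\<forall>S\<in>set_pmf R. \<forall>x :: nat \<Rightarrow> 'f.
       (\<forall>n<D + 1. sum x (S n) = 0) \<longrightarrow> (\<forall>i\<in>W. x i = 0)) \<and>
    (\<forall>n. map_pmf (\<lambda>S. S n) R = random_subset \<rho> {..<K})"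
  have "\<exists>R. ?good W R" if "W \<in> demand_sets K D" for W
    using ex_random_supports[OF that \<rho>, where 'f = 'f] by metis
  then obtain R where R: "\<And>W. W \<in> demand_sets K D \<Longrightarrow> ?good W (R W)"
    by metis
  define P :: "nat set \<Rightarrow> (nat \<Rightarrow> 'f query) pmf" where
    "P W = map_pmf (\<lambda>S n. indicator_query (S n)) (R W)" for W
  let ?M = "map_pmf indicator_query (random_subset \<rho> {..<K}) :: 'f query pmf"
  have marginal: "map_pmf (\<lambda>Q. Q n) (P W) = ?M" if "W \<in> demand_sets K D" for n W
  proof -
    have "map_pmf (\<lambda>Q. Q n) (P W) = map_pmf indicator_query (map_pmf (\<lambda>S. S n) (R W))"
      by (simp add: P_def map_pmf_comp)
    then show ?thesis using R[OF that] by simp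
  qed
  have joint: "map_pmf (\<lambda>(W, Q). Q n) (joint_dist K D P) = ?M" for n
  proof -
    have "map_pmf (\<lambda>(W, Q). Q n) (joint_dist K D P)
        = bind_pmf (pmf_of_set (demand_sets K D)) (\<lambda>W. map_pmf (\<lambda>Q. Q n) (P W))"
      by (simp add: joint_dist_def map_bind_pmf map_pmf_comp)
    also have "\<dots> = bind_pmf (pmf_of_set (demand_sets K D)) (\<lambda>W. ?M)"
      using finite_demand_sets[of K D] demand_sets_nonempty[OF \<open>D \<le> K\<close>]
      by (intro bind_pmf_cong refl marginal) simp
    finally show ?thesis by simp
  qed
  have len: "real (length (indicator_query S :: 'f query)) = 1 - indicator {{}} S" for S
    by (auto simp: indicator_query_def)
  have "integrable (measure_pmf (joint_dist K D P)) (\<lambda>(W, Q). real (length (Q n)))" for n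
  proof -
    have "integrable (measure_pmf ?M) (\<lambda>q. real (length q))"
      unfolding integrable_map_pmf_eq len
      by (rule integrable_bounded_pmf[where b = 1]) (auto simp: indicator_def)
    then show ?thesis
      unfolding joint[of n, symmetric] integrable_map_pmf_eq by (simp add: case_prod_unfold)
  qed
  moreover have "private_protocol (D + 1) K D P"
    unfolding private_protocol_iff_marginals[OF \<open>D \<le> K\<close>] by (simp add: marginal joint)
  moreover have "recoverable_protocol TYPE('m) (D + 1) K D P"
    unfolding recoverable_protocol_def
  proof (intro ballI allI impI)
    fix W Q i and X X' :: "nat \<Rightarrow> 'm \<Rightarrow> 'f"
    assume W: "W \<in> demand_sets K D" and "Q \<in> set_pmf (P W)" and i: "i \<in> W"
      and eq: "\<forall>n<D + 1. answer K (Q n) X = answer K (Q n) X'"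
    then obtain S where S: "S \<in> set_pmf (R W)" "Q = (\<lambda>n. indicator_query (S n))"
      by (auto simp: P_def)
    have "S n \<subseteq> {..<K}" for n
    proof -
      have "S n \<in> set_pmf (map_pmf (\<lambda>S. S n) (R W))" using S(1) by auto
      then show ?thesis
        using R[OF W] \<rho> by (simp add: set_pmf_iff pmf_random_subset split: if_splits)
    qed
    then have "(\<Sum>k\<in>S n. X k j - X' k j) = 0" if "n < D + 1" for n j
      using eq that S(2) by (intro answer_indicator_query_eqD) auto
    then have "X i j - X' i j = 0" for j
      using R[OF W] S(1) i by blast
    then show "X i = X' i" by auto
  qed
  moreover have "expected_download TYPE('f) TYPE('m) (D + 1) K D P
      = real (D + 1) * (1 - 1 / real (D + 1) ^ r) * msg_bits TYPE('f) TYPE('m)"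
  proof -
    \<comment> \<open>As \<open>K = r * D\<close>, the normalisation over all messages is the
      \<open>r\<close>-th power of that over one block.\<close>
    have "(1 + \<rho>) ^ K = real (D + 1) ^ r"
      using \<rho>(2) \<open>K = r * D\<close> by (simp add: power_mult mult.commute[of r D] add.commute)
    then have null: "pmf (random_subset \<rho> {..<K}) {} = 1 / real (D + 1) ^ r"
      using \<rho>(1) by (simp add: pmf_random_subset)
    have "measure_pmf.expectation (joint_dist K D P) (\<lambda>(W, Q). real (length (Q n)) * msg_bits TYPE('f) TYPE('m))
        = (1 - 1 / real (D + 1) ^ r) * msg_bits TYPE('f) TYPE('m)" for n
    proof -
      have "measure_pmf.expectation (joint_dist K D P) (\<lambda>(W, Q). real (length (Q n)) * msg_bits TYPE('f) TYPE('m))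
          = measure_pmf.expectation (map_pmf (\<lambda>(W, Q). Q n) (joint_dist K D P)) (\<lambda>q. real (length q))
              * msg_bits TYPE('f) TYPE('m)"
        by (simp add: case_prod_unfold)
      also have "\<dots> = measure_pmf.expectation (random_subset \<rho> {..<K}) (\<lambda>S. 1 - indicator {{}} S)
              * msg_bits TYPE('f) TYPE('m)"
        unfolding joint integral_map_pmf len ..
      also have "measure_pmf.expectation (random_subset \<rho> {..<K}) (\<lambda>S. 1 - indicator {{}} S)
          = 1 - pmf (random_subset \<rho> {..<K}) {}"
        by (subst Bochner_Integration.integral_diff)
          (auto simp: measure_pmf_single indicator_def intro: integrable_bounded_pmf[where b = 1])
      finally show ?thesis unfolding null .
    qed
    then show ?thesis by (simp add: expected_download_def)
  qed
  ultimately show thesis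
    using that[of P] unfolding linear_MPIR_protocol_def by blast
qed

text \<open>The geometric sum of ratio \<open>1 / (D + 1)\<close>, by which the lower bound on the
  download meets the cost of the protocol.\<close>

lemma sum_geometric_capacity:
  fixes D r :: nat
  shows "(\<Sum>j<r. real D / real (D + 1) ^ j) = real (D + 1) * (1 - 1 / real (D + 1) ^ r)"
proof (induction r)
  case (Suc r)
  have "real D / x + real (D + 1) * (1 - 1 / x) = real (D + 1) * (1 - 1 / (real (D + 1) * x))"
    if "0 < x" for x :: real
  proof -
    have "0 < x + x * real D" using that by (simp add: add_pos_nonneg)
    then show ?thesis using that by (simp add: field_simps)
  qed
  from this[of "real (D + 1) ^ r"] show ?case using Suc.IH by simp
qed simp

theorem theorem2:
  fixes K D N :: nat
  assumes "1 < K" and "1 < D" and "D \<le> K" and "D dvd K" and "N = D + 1"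
  shows "linear_capacity TYPE('f::{field,finite}) TYPE('m::finite) N K D
           = (1 - 1 / real N) / (1 - 1 / real N ^ (K div D))"
proof -
  define r where "r = K div D"
  have r: "K = r * D" "0 < r" "0 < D"
    using assms by (auto simp: r_def div_greater_zero_iff)
  let ?B = "msg_bits TYPE('f) TYPE('m)"
  let ?L = "real N * (1 - 1 / real N ^ r)"
  have B: "0 < ?B"
    using one_less_CARD_field[where 'f = 'f] by (simp add: msg_bits_def)
  have "1 < real N ^ r"
    using assms r by (intro one_less_power) auto
  then have L: "0 < ?L"
    using assms by simp
  \<comment> \<open>Writes the claimed value as the rate of a protocol with expected download
    \<open>?L\<close> messages, using \<open>N - 1 = D\<close>.\<close>
  have C: "(1 - 1 / real N) / (1 - 1 / real N ^ r) = real D * ?B / (?L * ?B)"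
  proof -
    have "1 - 1 / real N = real D / real N"
      using assms by (simp add: field_simps)
    then show ?thesis using B by simp
  qed
  show ?thesis
    unfolding linear_capacity_def r_def[symmetric] C
  proof (rule cSup_eq_maximum)
    obtain P :: "nat set \<Rightarrow> (nat \<Rightarrow> 'f query) pmf" where
      "linear_MPIR_protocol TYPE('f) TYPE('m) N K D P"
      "expected_download TYPE('f) TYPE('m) N K D P = ?L * ?B"
      using ex_optimal_protocol[OF r(3) \<open>D \<le> K\<close> r(1)] \<open>N = D + 1\<close> by metis
    then show "real D * ?B / (?L * ?B)
        \<in> {rate TYPE('f) TYPE('m) N K D P |P. linear_MPIR_protocol TYPE('f) TYPE('m) N K D P}"
      unfolding rate_def by (metis (mono_tags, lifting) mem_Collect_eq)
  next
    fix c
    assume "c \<in> {rate TYPE('f) TYPE('m) N K D P |P. linear_MPIR_protocol TYPE('f) TYPE('m) N K D P}"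
    then obtain P where P: "linear_MPIR_protocol TYPE('f) TYPE('m) N K D P"
      and c: "c = rate TYPE('f) TYPE('m) N K D P" by blast
    have "?L * ?B \<le> expected_download TYPE('f) TYPE('m) N K D P"
      using expected_download_lower_bound[OF P _ r(1,2)] sum_geometric_capacity[of D r]
        \<open>N = D + 1\<close> by simp
    then show "c \<le> real D * ?B / (?L * ?B)"
      unfolding c rate_def using B by (intro frac_le mult_pos_pos[OF L B]) simp_all
  qed
qed

end
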